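(* Let $\omega=(\omega_1,\ldots,\omega_n)\in\mathbb{D}^n$ and $\alpha=(\alpha_1,\ldots,\alpha_n)\in\mathbb{C}^n$ be such that each of the (mutually commuting) matrices \[T_j=\begin{pmatrix}\omega_j&\alpha_j&0\\0&\omega_j&\alpha_j\\0&0&\omega_j\end{pmatrix},\qquad j=1,\ldots,n,\] is a contraction on $\mathbb{C}^3$. Then the homomorphism $\rho_{T,\omega}:H^\infty(\mathbb{D}^n)\to\mathcal{B}(\mathbb{C}^3)$ induced by $T=(T_1,\ldots,T_n)$, \[\rho_{T,\omega}(f)=\begin{pmatrix}f(\omega)&Df(\omega)\cdot\alpha&\frac12D^2f(\omega)\cdot A_{\alpha\alpha}\\0&f(\omega)&Df(\omega)\cdot\alpha\\0&0&f(\omega)\end{pmatrix},\] is contractive, i.e. $\|\rho_{T,\omega}(f)\|\le\|f\|_{\mathbb{D}^n,\infty}$ for all $f\in H^\infty(\mathbb{D}^n)$.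
   Context: $\mathbb{D}$ is the open unit disc; $H^\infty(\mathbb{D}^n)$ is the algebra of bounded holomorphic functions on $\mathbb{D}^n$ with $\|f\|_{\mathbb{D}^n,\infty}=\sup_{\mathbb{D}^n}|f|$. $Df(\omega)\cdot\alpha=\sum_j\frac{\partial f}{\partial z_j}(\omega)\alpha_j$ and $D^2f(\omega)\cdot A_{\alpha\alpha}=\sum_{j,k}\frac{\partial^2f}{\partial z_j\partial z_k}(\omega)\alpha_j\alpha_k$. For a polynomial $p$, $\rho_{T,\omega}(p)=p(T_1,\ldots,T_n)$. Matrix norms are operator norms. *)

theory Defs
  imports "HOL-Complex_Analysis.Complex_Analysis"
begin

definition polydisc :: "(complex ^ 'n) set" where
  "polydisc = {z. \<forall>j. z $ j \<in> ball 0 1}"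

text \<open>Holomorphy in several variables, for an open set: at every point the Frechet derivative
  exists and is complex linear.\<close>

definition holomorphic_Cn_on :: "(complex ^ 'n \<Rightarrow> complex) \<Rightarrow> (complex ^ 'n) set \<Rightarrow> bool" where
  "holomorphic_Cn_on f S \<longleftrightarrow>
     (\<forall>z\<in>S. \<exists>f'. (f has_derivative f') (at z) \<and> (\<forall>c v. f' (c *s v) = c * f' v))"

text \<open>Elements are total functions; only their restrictions to the polydisc matter.\<close>

definition H_inf :: "(complex ^ 'n \<Rightarrow> complex) set" where
  "H_inf = {f. holomorphic_Cn_on f polydisc \<and> bounded (f ` polydisc)}"

definition polydisc_norm :: "(complex ^ 'n \<Rightarrow> complex) \<Rightarrow> real" where
  "polydisc_norm f = (SUP z\<in>polydisc. cmod (f z))"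

definition partial_deriv ::
  "'n \<Rightarrow> (complex ^ 'n \<Rightarrow> complex) \<Rightarrow> complex ^ 'n \<Rightarrow> complex" where
  "partial_deriv j f z = deriv (\<lambda>t. f (z + t *s axis j 1)) 0"

definition D1 :: "(complex ^ 'n \<Rightarrow> complex) \<Rightarrow> complex ^ 'n \<Rightarrow> complex ^ 'n \<Rightarrow> complex" where
  "D1 f \<omega> \<alpha> = (\<Sum>j\<in>UNIV. partial_deriv j f \<omega> * \<alpha> $ j)"

definition D2 :: "(complex ^ 'n \<Rightarrow> complex) \<Rightarrow> complex ^ 'n \<Rightarrow> complex ^ 'n \<Rightarrow> complex" where
  "D2 f \<omega> \<alpha> = (\<Sum>j\<in>UNIV. \<Sum>k\<in>UNIV. partial_deriv j (partial_deriv k f) \<omega> * \<alpha> $ j * \<alpha> $ k)"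

text \<open>The norm on \<^typ>\<open>complex ^ 3\<close> is the Euclidean one, so this is the operator norm on
  the Hilbert space.\<close>

definition matrix_norm :: "complex ^ 3 ^ 3 \<Rightarrow> real" where
  "matrix_norm A = onorm (\<lambda>v. A *v v)"

definition upper_toeplitz :: "complex \<Rightarrow> complex \<Rightarrow> complex \<Rightarrow> complex ^ 3 ^ 3" where
  "upper_toeplitz a b c =
     vector [vector [a, b, c],
             vector [0, a, b],
             vector [0, 0, a]]"

definition T_mat :: "complex ^ 'n \<Rightarrow> complex ^ 'n \<Rightarrow> 'n \<Rightarrow> complex ^ 3 ^ 3" where
  "T_mat \<omega> \<alpha> j = upper_toeplitz (\<omega> $ j) (\<alpha> $ j) 0"

definition rho :: "complex ^ 'n \<Rightarrow> complex ^ 'n \<Rightarrow> (complex ^ 'n \<Rightarrow> complex) \<Rightarrow> complex ^ 3 ^ 3" where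
  "rho \<omega> \<alpha> f = upper_toeplitz (f \<omega>) (D1 f \<omega> \<alpha>) (D2 f \<omega> \<alpha> / 2)"

text \<open>A unital homomorphism of complex algebras on \<^const>\<open>H_inf\<close> that sends the coordinate
  functions to the given matrices; hence it sends every polynomial \<open>p\<close> to \<open>p(T)\<close>.
  Multiplying by \<^term>\<open>mat c\<close> is scaling by \<open>c\<close>.\<close>

definition hom_induced_by ::
  "('n \<Rightarrow> complex ^ 3 ^ 3) \<Rightarrow> ((complex ^ 'n \<Rightarrow> complex) \<Rightarrow> complex ^ 3 ^ 3) \<Rightarrow> bool" where
  "hom_induced_by T \<rho> \<longleftrightarrow>
     \<rho> (\<lambda>z. 1) = mat 1 \<and>
     (\<forall>f\<in>H_inf. \<forall>g\<in>H_inf. \<rho> (\<lambda>z. f z + g z) = \<rho> f + \<rho> g) \<and>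
     (\<forall>f\<in>H_inf. \<forall>c. \<rho> (\<lambda>z. c * f z) = mat c ** \<rho> f) \<and>
     (\<forall>f\<in>H_inf. \<forall>g\<in>H_inf. \<rho> (\<lambda>z. f z * g z) = \<rho> f ** \<rho> g) \<and>
     (\<forall>j. \<rho> (\<lambda>z. z $ j) = T j)"

lemma T_mat_commute: "T_mat \<omega> \<alpha> i ** T_mat \<omega> \<alpha> j = T_mat \<omega> \<alpha> j ** T_mat \<omega> \<alpha> i"
  by (simp add: T_mat_def upper_toeplitz_def vec_eq_iff forall_3 matrix_matrix_mult_def sum_3
      algebra_simps)

end

theory Submission
  imports Defs
begin

text \<open>
  The matrix \<open>rho \<omega> \<alpha> f\<close> depends on the second-order jet of \<open>f\<close> along the line \<open>\<omega> + \<alpha> z\<close> only, so the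
  line may be replaced by any curve with the same second-order jet at 0.  The contractivity of the
  matrices \<open>T\<^sub>j\<close> allows a curve that stays in the polydisc for all \<open>z\<close> in the unit disc.  Indeed,
  \<open>T\<^sub>j\<close> is the Toeplitz matrix with coefficients \<open>\<omega>\<^sub>j, \<alpha>\<^sub>j, 0\<close>, and by the theory of Caratheodory and
  Schur its contractivity is the solvability of the interpolation problem
  \<open>\<phi>\<^sub>j(z) = \<omega>\<^sub>j + \<alpha>\<^sub>j z + O(z^3)\<close> by a holomorphic self-map of the disc.  For this data the criterion reads
  \<open>|\<alpha>\<^sub>j|\<^sup>2 \<le> (1 - |\<omega>\<^sub>j|) (1 - |\<omega>\<^sub>j|\<^sup>2)\<close>; it is deduced from contractivity in
  \<open>upper_toeplitz_contraction_bound\<close>, and \<open>Schur_interpolation\<close> constructs the solution from it.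

  With \<open>\<phi> = (\<phi>\<^sub>1, \<dots>, \<phi>\<^sub>n)\<close>, the function \<open>F = f \<circ> \<phi>\<close> is holomorphic on the disc and bounded by the norm of
  \<open>f\<close>, and \<open>rho \<omega> \<alpha> f\<close> is the Toeplitz matrix of its first three Taylor coefficients
  (\<open>rho_eq_upper_toeplitz_compose\<close>).  Such a matrix is a compression of the multiplication by \<open>F\<close>
  on the Hardy space, so its norm is at most the supremum of \<open>|F|\<close>
  (\<open>Toeplitz_section_contractive\<close>).  The homomorphism property is inherited from the product rule in one variable.

  The chain rule to second order requires that the partial derivatives of a complex
  differentiable function are again complex differentiable (\<open>holomorphic_Cn_partial_deriv\<close>).
\<close>

unbundle no fps_syntax

section \<open>Toeplitz matrices of bounded holomorphic functions\<close>

text \<open>Cauchy's formula for derivatives in the form of a Fourier coefficient: on the circle of radius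
  \<open>R\<close> the conjugate of \<open>z^k\<close> is \<open>R^(2k) / z^k\<close>, and \<open>dz = 2 \<pi> \<i> z dx\<close>.  So the circle means against
  conjugated monomials read off Taylor coefficients.\<close>

lemma has_integral_circle_coefficient:
  fixes g :: "complex \<Rightarrow> complex"
  assumes g: "g holomorphic_on ball 0 1" and R: "0 < R" "R < 1"
  shows "((\<lambda>x. g (circlepath 0 R x) * cnj (circlepath 0 R x ^ k))
           has_integral (of_real (R ^ (2 * k)) * ((deriv ^^ k) g 0 / fact k))) {0..1}"
proof -
  let ?c = "circlepath 0 R"
  have "continuous_on (cball 0 R) g" "g holomorphic_on ball 0 R"
    using R by (auto intro!: holomorphic_on_imp_continuous_on holomorphic_on_subset[OF g])
  then have "((\<lambda>u. g u / (u - 0) ^ Suc k) has_contour_integral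
      2 * pi * \<i> / fact k * (deriv ^^ k) g 0) ?c"
    by (rule Cauchy_has_contour_integral_higher_derivative_circlepath) (use R in auto)
  then have "((\<lambda>x. g (?c x) / (?c x) ^ Suc k * vector_derivative ?c (at x within {0..1}))
      has_integral (2 * pi * \<i> / fact k * (deriv ^^ k) g 0)) {0..1}"
    by (simp add: has_contour_integral_def)
  from has_integral_mult_right[OF this, of "R ^ (2 * k) / (2 * pi * \<i>)"]
  show ?thesis
  proof (rule has_integral_eq_rhs[OF has_integral_eq, rotated])
    fix x :: real assume x: "x \<in> {0..1}"
    have vd: "vector_derivative ?c (at x within {0..1}) = 2 * pi * \<i> * ?c x"
      using x vector_derivative_circlepath01[of x 0 R] by (simp add: circlepath mult_ac)
    have nz: "?c x \<noteq> 0"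
      using R by (simp add: circlepath)
    have "?c x ^ k * cnj (?c x ^ k) = of_real (R ^ (2 * k))"
      using R by (simp only: complex_norm_square[symmetric])
        (simp add: circlepath norm_mult norm_power power_mult[symmetric] mult.commute)
    then have "of_real (R ^ (2 * k)) / ?c x ^ k = cnj (?c x ^ k)"
      using nz by (simp add: field_simps)
    then show "complex_of_real (R ^ (2 * k)) / (2 * pi * \<i>) *
        (g (?c x) / ?c x ^ Suc k * vector_derivative ?c (at x within {0..1}))
        = g (?c x) * cnj (?c x ^ k)"
      unfolding vd using nz by (simp add: field_simps)
  qed (simp add: field_simps)
qed

lemma has_integral_circle_polynomial:
  fixes g :: "complex \<Rightarrow> complex" and b :: "nat \<Rightarrow> complex"
  assumes g: "g holomorphic_on ball 0 1" and R: "0 < R" "R < 1"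
  shows "((\<lambda>x. g (circlepath 0 R x) * cnj (\<Sum>k<N. b k * circlepath 0 R x ^ k))
           has_integral (\<Sum>k<N. of_real (R ^ (2 * k)) * ((deriv ^^ k) g 0 / fact k * cnj (b k)))) {0..1}"
proof -
  have "((\<lambda>x. \<Sum>k<N. cnj (b k) * (g (circlepath 0 R x) * cnj (circlepath 0 R x ^ k)))
      has_integral (\<Sum>k<N. cnj (b k) * (of_real (R ^ (2 * k)) * ((deriv ^^ k) g 0 / fact k)))) {0..1}"
    by (intro has_integral_sum has_integral_mult_right) (simp_all only: has_integral_circle_coefficient[OF g R] finite_lessThan)
  then show ?thesis
    by (simp add: sum_distrib_left mult_ac)
qed

lemma higher_deriv_polynomial_at_0:
  fixes b :: "nat \<Rightarrow> complex"
  assumes "k < N"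
  shows "(deriv ^^ k) (\<lambda>z. \<Sum>i<N. b i * z ^ i) 0 = fact k * b k"
proof -
  have mono: "(deriv ^^ k) (\<lambda>z. b i * z ^ i) 0 = (if i = k then fact k * b k else 0)" for i
  proof -
    have "(deriv ^^ k) (\<lambda>z. b i * z ^ i) 0 = b i * (deriv ^^ k) (\<lambda>z. (z - 0) ^ i) 0"
      by (subst higher_deriv_cmult[where A = UNIV])
         (auto intro!: holomorphic_intros)
    also have "(deriv ^^ k) (\<lambda>z::complex. (z - 0) ^ i) 0 = (if i = k then fact k else 0)"
      unfolding higher_deriv_power
      by (cases i k rule: linorder_cases)
        (auto simp: pochhammer_fact[symmetric] pochhammer_0_left Suc_diff_le zero_power)
    finally show ?thesis by simp
  qed
  have "(deriv ^^ k) (\<lambda>z. \<Sum>i<M. b i * z ^ i) 0 = (\<Sum>i<M. (deriv ^^ k) (\<lambda>z. b i * z ^ i) 0)" for M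
  proof (induction M)
    case 0 show ?case by (simp add: higher_deriv_const)
  next
    case (Suc M)
    then show ?case
      by (simp, subst higher_deriv_add[where S = UNIV]) (auto intro!: holomorphic_intros)
  qed
  then show ?thesis
    using assms by (simp add: mono)
qed

text \<open>The lower triangular Toeplitz matrix of the first \<open>N\<close> Taylor coefficients of \<open>F\<close> maps the
  coefficients of a polynomial \<open>q\<close> of degree below \<open>N\<close> to the initial coefficients of \<open>F q\<close>.
  Multiplication by \<open>F\<close> increases the mean square on a circle at most by the factor \<open>M\<^sup>2\<close>, and
  truncating the power series decreases it.  Both facts are combined pointwise: with \<open>g = F q\<close> and its
  truncation \<open>p\<close>, the expansion of \<open>|g - p|\<^sup>2 \<ge> 0\<close> gives
  \<open>2 Re (g cnj p) - |p|\<^sup>2 \<le> |g|\<^sup>2 \<le> M\<^sup>2 |q|\<^sup>2\<close>, and the means of the two outer terms are known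
  from the coefficients.  The radius then tends to 1.\<close>

theorem Toeplitz_section_contractive:
  fixes F :: "complex \<Rightarrow> complex" and c :: "nat \<Rightarrow> complex"
  assumes F: "F holomorphic_on ball 0 1" and M: "\<And>z. z \<in> ball 0 1 \<Longrightarrow> cmod (F z) \<le> M"
  shows "(\<Sum>k<N. (cmod (\<Sum>i\<le>k. (deriv ^^ i) F 0 / fact i * c (k - i)))\<^sup>2) \<le> M\<^sup>2 * (\<Sum>k<N. (cmod (c k))\<^sup>2)"
proof -
  define q where "q = (\<lambda>z. \<Sum>k<N. c k * z ^ k)"
  define g where "g = (\<lambda>z. F z * q z)"
  define b where "b = (\<lambda>k. \<Sum>i\<le>k. (deriv ^^ i) F 0 / fact i * c (k - i))"
  define p where "p = (\<lambda>z. \<Sum>k<N. b k * z ^ k)"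
  have q: "q holomorphic_on ball 0 1" and p: "p holomorphic_on ball 0 1"
    unfolding q_def p_def by (auto intro!: holomorphic_intros)
  have g: "g holomorphic_on ball 0 1"
    unfolding g_def by (intro holomorphic_intros F q)
  have gk: "(deriv ^^ k) g 0 / fact k = b k" if "k < N" for k
  proof -
    have "(deriv ^^ k) g 0 =
        (\<Sum>i=0..k. of_nat (k choose i) * (deriv ^^ i) F 0 * (deriv ^^ (k - i)) q 0)"
      unfolding g_def by (rule higher_deriv_mult[OF F q]) auto
    also have "\<dots> = (\<Sum>i\<le>k. fact k * ((deriv ^^ i) F 0 / fact i * c (k - i)))"
    proof (rule sum.cong)
      fix i assume "i \<in> {..k}"
      then show "of_nat (k choose i) * (deriv ^^ i) F 0 * (deriv ^^ (k - i)) q 0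
          = fact k * ((deriv ^^ i) F 0 / fact i * c (k - i))"
        using that unfolding q_def
        by (simp add: higher_deriv_polynomial_at_0 binomial_fact)
    qed auto
    finally have "(deriv ^^ k) g 0 = fact k * b k"
      by (simp only: b_def sum_distrib_left)
    then show ?thesis by simp
  qed
  have qk: "(deriv ^^ k) q 0 / fact k = c k" and pk: "(deriv ^^ k) p 0 / fact k = b k"
    if "k < N" for k
    using that by (simp_all add: q_def p_def higher_deriv_polynomial_at_0)
  have p_eval: "(\<Sum>k<N. b k * z ^ k) = p z" and q_eval: "(\<Sum>k<N. c k * z ^ k) = q z" for z
    by (simp_all add: p_def q_def)
  have radius: "(\<Sum>k<N. R ^ (2 * k) * (cmod (b k))\<^sup>2) \<le> M\<^sup>2 * (\<Sum>k<N. R ^ (2 * k) * (cmod (c k))\<^sup>2)"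
    if R: "0 < R" "R < 1" for R
  proof -
    let ?c = "circlepath 0 R"
    have gp: "((\<lambda>x. g (?c x) * cnj (p (?c x))) has_integral
        complex_of_real (\<Sum>k<N. R ^ (2 * k) * (cmod (b k))\<^sup>2)) {0..1}"
      using has_integral_circle_polynomial[OF g R, of b N, unfolded p_eval]
      by (simp add: gk complex_norm_square[symmetric])
    have pp: "((\<lambda>x. p (?c x) * cnj (p (?c x))) has_integral
        complex_of_real (\<Sum>k<N. R ^ (2 * k) * (cmod (b k))\<^sup>2)) {0..1}"
      using has_integral_circle_polynomial[OF p R, of b N, unfolded p_eval]
      by (simp add: pk complex_norm_square[symmetric])
    have qq: "((\<lambda>x. q (?c x) * cnj (q (?c x))) has_integral
        complex_of_real (\<Sum>k<N. R ^ (2 * k) * (cmod (c k))\<^sup>2)) {0..1}"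
      using has_integral_circle_polynomial[OF q R, of c N, unfolded q_eval]
      by (simp add: qk complex_norm_square[symmetric])
    have lower: "((\<lambda>x. 2 * Re (g (?c x) * cnj (p (?c x))) - Re (p (?c x) * cnj (p (?c x))))
        has_integral (2 * (\<Sum>k<N. R ^ (2 * k) * (cmod (b k))\<^sup>2)
                      - (\<Sum>k<N. R ^ (2 * k) * (cmod (b k))\<^sup>2))) {0..1}"
      using has_integral_Re[OF gp] has_integral_Re[OF pp]
      by (intro has_integral_diff has_integral_mult_right) simp_all
    have upper: "((\<lambda>x. M\<^sup>2 * Re (q (?c x) * cnj (q (?c x))))
        has_integral (M\<^sup>2 * (\<Sum>k<N. R ^ (2 * k) * (cmod (c k))\<^sup>2))) {0..1}"
      using has_integral_Re[OF qq] by (intro has_integral_mult_right) simp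
    have "2 * (\<Sum>k<N. R ^ (2 * k) * (cmod (b k))\<^sup>2) - (\<Sum>k<N. R ^ (2 * k) * (cmod (b k))\<^sup>2)
        \<le> M\<^sup>2 * (\<Sum>k<N. R ^ (2 * k) * (cmod (c k))\<^sup>2)"
    proof (rule has_integral_le[OF lower upper])
      fix x :: real assume "x \<in> {0..1}"
      define z where "z = ?c x"
      have "cmod z = R"
        using R by (simp add: z_def circlepath norm_mult)
      then have "cmod (F z) \<le> M" using M R by auto
      have "0 \<le> (cmod (g z - p z))\<^sup>2" by simp
      also have "\<dots> = (cmod (g z))\<^sup>2 - 2 * Re (g z * cnj (p z)) + Re (p z * cnj (p z))"
        unfolding cmod_power2 by (simp add: algebra_simps power2_eq_square)
      also have "(cmod (g z))\<^sup>2 \<le> M\<^sup>2 * (cmod (q z))\<^sup>2"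
        unfolding g_def norm_mult power_mult_distrib
        using \<open>cmod (F z) \<le> M\<close> by (intro mult_right_mono power_mono) auto
      also have "(cmod (q z))\<^sup>2 = Re (q z * cnj (q z))"
        unfolding cmod_power2 by (simp add: power2_eq_square)
      finally show "2 * Re (g (?c x) * cnj (p (?c x))) - Re (p (?c x) * cnj (p (?c x)))
          \<le> M\<^sup>2 * Re (q (?c x) * cnj (q (?c x)))"
        unfolding z_def by linarith
    qed
    then show ?thesis by simp
  qed
  have "(\<Sum>k<N. 1 ^ (2 * k) * (cmod (b k))\<^sup>2) \<le> M\<^sup>2 * (\<Sum>k<N. 1 ^ (2 * k) * (cmod (c k))\<^sup>2)"
  proof (rule tendsto_le)
    show "((\<lambda>R. M\<^sup>2 * (\<Sum>k<N. R ^ (2 * k) * (cmod (c k))\<^sup>2)) \<longlongrightarrow>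
        M\<^sup>2 * (\<Sum>k<N. 1 ^ (2 * k) * (cmod (c k))\<^sup>2)) (at_left 1)"
      by (intro tendsto_intros)
    show "((\<lambda>R. \<Sum>k<N. R ^ (2 * k) * (cmod (b k))\<^sup>2) \<longlongrightarrow>
        (\<Sum>k<N. 1 ^ (2 * k) * (cmod (b k))\<^sup>2)) (at_left 1)"
      by (intro tendsto_intros)
    show "\<forall>\<^sub>F R in at_left 1. (\<Sum>k<N. R ^ (2 * k) * (cmod (b k))\<^sup>2)
        \<le> M\<^sup>2 * (\<Sum>k<N. R ^ (2 * k) * (cmod (c k))\<^sup>2)"
      unfolding eventually_at_left_field using radius zero_less_one by blast
  qed simp
  then show ?thesis by (simp add: b_def)
qed

lemma matrix_vector_upper_toeplitz:
  "(upper_toeplitz a b c *v v) $ 1 = a * v $ 1 + b * v $ 2 + c * v $ 3"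
  "(upper_toeplitz a b c *v v) $ 2 = a * v $ 2 + b * v $ 3"
  "(upper_toeplitz a b c *v v) $ 3 = a * v $ 3"
  by (simp_all add: upper_toeplitz_def matrix_vector_mult_def sum_3)

lemma norm_square_complex3:
  fixes v :: "complex ^ 3"
  shows "(norm v)\<^sup>2 = (cmod (v $ 1))\<^sup>2 + (cmod (v $ 2))\<^sup>2 + (cmod (v $ 3))\<^sup>2"
  by (simp add: norm_vec_def L2_set_def sum_3)

text \<open>The upper triangular form arises by listing the coefficients of the polynomial in
  decreasing order of degree.\<close>

corollary matrix_norm_upper_toeplitz_le:
  assumes F: "F holomorphic_on ball 0 1" and M: "\<And>z. z \<in> ball 0 1 \<Longrightarrow> cmod (F z) \<le> M"
  shows "matrix_norm (upper_toeplitz (F 0) (deriv F 0) (deriv (deriv F) 0 / 2)) \<le> M"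
  unfolding matrix_norm_def
proof (rule onorm_le)
  fix v :: "complex ^ 3"
  define c where "c = (\<lambda>k::nat. if k = 0 then v $ 3 else if k = 1 then v $ 2 else v $ 1)"
  have "M \<ge> 0" using M[of 0] norm_ge_zero[of "F 0"] by (simp del: norm_ge_zero)
  have "(norm (upper_toeplitz (F 0) (deriv F 0) (deriv (deriv F) 0 / 2) *v v))\<^sup>2 \<le> M\<^sup>2 * (norm v)\<^sup>2"
    using Toeplitz_section_contractive[OF F M, where c = c and N = 3]
    unfolding norm_square_complex3 matrix_vector_upper_toeplitz
    by (simp add: c_def eval_nat_numeral algebra_simps)
  then show "norm (upper_toeplitz (F 0) (deriv F 0) (deriv (deriv F) 0 / 2) *v v) \<le> M * norm v"
    using \<open>M \<ge> 0\<close> by (metis mult_nonneg_nonneg norm_ge_zero power2_le_imp_le power_mult_distrib)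
qed

section \<open>Interpolation by self-maps of the disc\<close>

text \<open>The bound comes from a single test vector.  Write \<open>r = |w|\<close>, \<open>w = r u\<close> with \<open>u\<close> unimodular and
  \<open>d = 1 - r\<^sup>2\<close>.  When the asserted inequality is an equality, the defect form \<open>|v|\<^sup>2 - |T v|\<^sup>2\<close> is
  degenerate, and a null vector is \<open>v = (cnj w a, d, cnj a u)\<close>, whose phases make all cross
  terms add up.  In general this vector has \<open>T v = (a, (r d + |a|\<^sup>2) u, w cnj a u)\<close>, and
  comparing norms leaves \<open>(r d + |a|\<^sup>2)\<^sup>2 \<le> d\<^sup>2\<close>.\<close>

lemma upper_toeplitz_contraction_bound:
  fixes w a :: complex
  assumes "matrix_norm (upper_toeplitz w a 0) \<le> 1" and w: "cmod w < 1"
  shows "(cmod a)\<^sup>2 \<le> (1 - cmod w) * (1 - (cmod w)\<^sup>2)"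
proof -
  define r where "r = cmod w"
  define d where "d = 1 - r\<^sup>2"
  obtain u :: complex where u: "cmod u = 1" "w = r * u"
  proof (cases "w = 0")
    case False
    then show ?thesis by (intro that[of "w / of_real r"]) (auto simp: r_def norm_divide)
  qed (auto intro: that[of 1] simp: r_def)
  have r: "0 \<le> r" "r < 1" using w by (simp_all add: r_def)
  have "r\<^sup>2 < 1" using r by (simp add: power_less_one_iff abs_square_less_1)
  then have d: "0 < d" by (simp add: d_def)
  define v :: "complex ^ 3" where "v = vector [cnj w * a, of_real d, cnj a * u]"
  have v: "v $ 1 = cnj w * a" "v $ 2 = of_real d" "v $ 3 = cnj a * u"
    by (simp_all add: v_def)
  have "norm (upper_toeplitz w a 0 *v v) \<le> onorm ((*v) (upper_toeplitz w a 0)) * norm v"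
    by (rule onorm) simp
  also have "\<dots> \<le> norm v"
    using assms(1) unfolding matrix_norm_def by (simp add: mult_left_le_one_le onorm_pos_le)
  finally have le: "(norm (upper_toeplitz w a 0 *v v))\<^sup>2 \<le> (norm v)\<^sup>2"
    by (simp add: power_mono)
  have ww: "w * cnj w = of_real (r\<^sup>2)" and aa: "a * cnj a = of_real ((cmod a)\<^sup>2)"
    by (simp_all add: r_def complex_norm_square[symmetric])
  have e1: "w * (cnj w * a) + a * of_real d = a"
  proof -
    have "w * (cnj w * a) + a * of_real d = (w * cnj w + of_real d) * a"
      by (simp add: algebra_simps)
    then show ?thesis by (simp add: ww d_def flip: of_real_add)
  qed
  have e2: "w * of_real d + a * (cnj a * u) = of_real (r * d + (cmod a)\<^sup>2) * u"
  proof -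
    have "w * of_real d + a * (cnj a * u) = (r * d + a * cnj a) * u"
      using u(2) by (simp add: algebra_simps)
    then show ?thesis by (simp add: aa)
  qed
  have "(cmod a)\<^sup>2 + (r * d + (cmod a)\<^sup>2)\<^sup>2 + r\<^sup>2 * (cmod a)\<^sup>2 \<le> r\<^sup>2 * (cmod a)\<^sup>2 + d\<^sup>2 + (cmod a)\<^sup>2"
    using le unfolding norm_square_complex3 matrix_vector_upper_toeplitz v
    by (simp add: e1 e2 norm_mult u(1) r_def power_mult_distrib del: of_real_add of_real_mult)
  then have "(r * d + (cmod a)\<^sup>2)\<^sup>2 \<le> d\<^sup>2" by linarith
  then have "r * d + (cmod a)\<^sup>2 \<le> d"
    by (rule power2_le_imp_le) (use d in simp)
  then show ?thesis
    by (simp add: r_def[symmetric] d_def[symmetric] algebra_simps)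
qed

text \<open>It shows that a disc automorphism \<open>x \<mapsto> (s + x) / (1 + cnj s x)\<close> preserves the disc; stated without
  the quotient it also covers \<open>|s| = 1\<close>.\<close>

lemma cmod_Moebius_identity:
  "(cmod (1 + cnj s * x))\<^sup>2 - (cmod (s + x))\<^sup>2 = (1 - (cmod s)\<^sup>2) * (1 - (cmod x)\<^sup>2)"
  unfolding cmod_power2 by (simp add: algebra_simps power2_eq_square)

text \<open>The Schur algorithm for the Taylor data \<open>w, a, 0\<close>.  Two steps peel off the parameters
  \<open>w\<close>, \<open>s = a / (1 - |w|\<^sup>2)\<close> and \<open>t = cnj w s\<^sup>2 / (1 - |s|\<^sup>2)\<close>; if \<open>|s| < 1\<close>, the bound on \<open>a\<close> is
  equivalent to \<open>|t| \<le> 1\<close>.  Running the algorithm backwards yields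
  \<open>(w + z \<psi>) / (1 + cnj w z \<psi>)\<close> with \<open>\<psi> = (s + t z) / (1 + cnj s t z)\<close>, a self-map of the disc.
  Clearing denominators, it is the quotient of \<open>w B + z (s + t z)\<close> by \<open>D\<close>, where \<open>B\<close> is the denominator
  of \<open>\<psi>\<close>.  Subtracting \<open>w + a z\<close> leaves \<open>- a cnj w t z^3 / D\<close>: the choice of \<open>s\<close> and \<open>t\<close>
  cancels the terms of orders 1 and 2.\<close>

lemma Schur_interpolation:
  fixes w a :: complex
  assumes w: "cmod w < 1" and a: "(cmod a)\<^sup>2 \<le> (1 - cmod w) * (1 - (cmod w)\<^sup>2)"
  obtains E where "E holomorphic_on ball 0 1"
    "\<And>z. z \<in> ball 0 1 \<Longrightarrow> cmod (w + a * z + z ^ 3 * E z) < 1"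
proof -
  define r where "r = cmod w"
  define d where "d = 1 - r\<^sup>2"
  define s where "s = a / of_real d"
  define x where "x = (cmod s)\<^sup>2"
  define t where "t = cnj w * s\<^sup>2 / of_real (1 - x)"
  have r: "0 \<le> r" "r < 1" using w by (simp_all add: r_def)
  have "r\<^sup>2 < 1" using r by (simp add: power_less_one_iff abs_square_less_1)
  then have d: "0 < d" by (simp add: d_def)
  have as: "a = of_real d * s" using d by (simp add: s_def)
  have "d\<^sup>2 * x \<le> (1 - r) * d"
    using a by (simp add: as x_def r_def[symmetric] d_def[symmetric] norm_mult power_mult_distrib)
  then have "d * x \<le> 1 - r"
    using d by (simp add: power2_eq_square)
  moreover have "d * x = (1 - r) * ((1 + r) * x)"
    by (simp add: d_def power2_eq_square algebra_simps)
  ultimately have "(1 + r) * x \<le> 1"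
    using r by (simp add: mult_le_cancel_left1)
  then have x: "r * x \<le> 1 - x" by (simp add: algebra_simps)
  have x0: "0 \<le> x" by (simp add: x_def)
  have x1: "x \<le> 1" using x r x0 by (smt (verit) mult_nonneg_nonneg)
  then have s1: "cmod s \<le> 1" by (simp add: x_def power_le_one_iff)
  have t1: "cmod t \<le> 1"
    using x x1 by (simp add: t_def norm_mult norm_divide norm_power x_def[symmetric]
        r_def[symmetric] divide_le_eq flip: of_real_diff)
  \<comment> \<open>If \<open>|s| = 1\<close>, then \<open>w = 0\<close>, and the division by zero gives the right value \<open>t = 0\<close>.\<close>
  have tx: "t * of_real (1 - x) = cnj w * s\<^sup>2"
  proof (cases "x = 1")
    case True
    then have "r = 0" using x r by simp
    then show ?thesis by (simp add: r_def True)
  qed (simp add: t_def del: of_real_diff)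
  define B where "B = (\<lambda>z. 1 + cnj s * t * z)"
  define D where "D = (\<lambda>z. B z + cnj w * (z * (s + t * z)))"
  have schur: "D z \<noteq> 0 \<and> cmod (w * B z + z * (s + t * z)) < cmod (D z)"
    if z: "cmod z < 1" for z
  proof -
    have tz: "cmod (t * z) < 1"
      using t1 z by (metis mult_left_le_one_le norm_ge_zero norm_mult order_le_less_trans)
    then have "cmod (cnj s * t * z) < 1"
      using s1 by (metis complex_mod_cnj mult.assoc mult_left_le_one_le norm_ge_zero norm_mult
          order_le_less_trans)
    then have B0: "B z \<noteq> 0"
      unfolding B_def by (metis add_eq_0_iff norm_minus_cancel norm_one order_less_irrefl)
    have "0 \<le> (1 - (cmod s)\<^sup>2) * (1 - (cmod (t * z))\<^sup>2)"
      using x1 tz by (intro mult_nonneg_nonneg) (auto simp: x_def power_le_one_iff)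
    then have "(cmod (s + t * z))\<^sup>2 \<le> (cmod (B z))\<^sup>2"
      using cmod_Moebius_identity[of s "t * z"] unfolding B_def mult.assoc by linarith
    then have "cmod (s + t * z) \<le> cmod (B z)"
      by (rule power2_le_imp_le) simp
    then have "cmod z * cmod (s + t * z) \<le> cmod z * cmod (B z)"
      by (simp add: mult_left_mono)
    also have "\<dots> < 1 * cmod (B z)"
      using z B0 by (intro mult_strict_right_mono) auto
    finally have "cmod (z * (s + t * z)) < cmod (B z)"
      by (simp add: norm_mult)
    define y where "y = z * (s + t * z) / B z"
    have yB: "z * (s + t * z) = B z * y" using B0 by (simp add: y_def)
    have y: "cmod y < 1"
      using \<open>cmod (z * (s + t * z)) < cmod (B z)\<close> B0 by (simp add: y_def norm_divide)
    have "0 < (1 - (cmod w)\<^sup>2) * (1 - (cmod y)\<^sup>2)"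
      using w y by (intro mult_pos_pos) (auto simp: abs_square_less_1)
    then have "(cmod (w + y))\<^sup>2 < (cmod (1 + cnj w * y))\<^sup>2"
      using cmod_Moebius_identity[of w y] by simp
    then have "cmod (w + y) < cmod (1 + cnj w * y)"
      by (rule power2_less_imp_less) simp
    moreover have "D z = B z * (1 + cnj w * y)" "w * B z + z * (s + t * z) = B z * (w + y)"
      unfolding D_def yB by (simp_all add: algebra_simps)
    ultimately show ?thesis
      using B0 by (auto simp: norm_mult)
  qed
  define E where "E = (\<lambda>z. - (a * cnj w * t) / D z)"
  show ?thesis
  proof
    show "E holomorphic_on ball 0 1"
      unfolding E_def using schur
      by (intro holomorphic_intros) (auto simp: D_def B_def intro!: holomorphic_intros)
    fix z :: complex assume "z \<in> ball 0 1"
    then have D0: "D z \<noteq> 0" and lt: "cmod (w * B z + z * (s + t * z)) < cmod (D z)"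
      using schur by auto
    have ww: "w * cnj w = 1 - of_real d" and ss: "s * cnj s = of_real x"
      by (simp_all add: d_def r_def x_def complex_norm_square[symmetric] of_real_diff)
    have "(w + a * z + z ^ 3 * E z) * D z = (w + a * z) * D z - a * cnj w * t * z ^ 3"
      using D0 by (simp add: E_def field_simps)
    also have "\<dots> = w * B z + (w * cnj w) * (z * (s + t * z)) + of_real d * z * s
        + of_real d * z\<^sup>2 * (s * cnj s * t + cnj w * s\<^sup>2)"
      unfolding D_def B_def as by (simp add: algebra_simps power2_eq_square power3_eq_cube)
    also have "\<dots> = w * B z + z * (s + t * z)"
      unfolding ww ss tx[symmetric] by (simp add: algebra_simps power2_eq_square)
    finally have "w + a * z + z ^ 3 * E z = (w * B z + z * (s + t * z)) / D z"
      using D0 by (simp add: field_simps)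
    then show "cmod (w + a * z + z ^ 3 * E z) < 1"
      using lt D0 by (simp add: norm_divide divide_less_eq)
  qed
qed

section \<open>Second-order calculus for holomorphic functions of several variables\<close>

lemma norm_smult_complex: "norm (c *s (v :: complex ^ 'n)) = cmod c * norm v"
  by (simp add: norm_vec_def L2_set_def norm_mult power_mult_distrib real_sqrt_mult
      flip: sum_distrib_left)

lemma norm_axis_complex: "norm (axis j 1 :: complex ^ 'n) = 1"
proof -
  have "(\<Sum>i\<in>UNIV. (cmod (axis j 1 $ i))\<^sup>2) = (\<Sum>i\<in>UNIV. if i = j then 1 else 0 :: real)"
    by (rule sum.cong) (auto simp: axis_def)
  then show ?thesis by (simp add: norm_vec_def L2_set_def)
qed

lemma bounded_linear_smult_left: "bounded_linear (\<lambda>c. c *s (v :: complex ^ 'n))"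
  by (rule bounded_linear_intro[where K = "norm v"])
     (vector algebra_simps, vector, simp add: norm_smult_complex)

lemma D1_axis: "D1 f z (axis j 1) = partial_deriv j f z"
  by (simp add: D1_def axis_def if_distrib cong: if_cong)

lemma D1_smult: "D1 f z (c *s v) = c * D1 f z v"
  by (simp add: D1_def sum_distrib_left mult_ac)

text \<open>This links the partial derivatives, which are defined along coordinate lines only, to the
  Frechet derivative.\<close>

lemma holomorphic_Cn_has_derivative_D1:
  fixes f :: "complex ^ 'n \<Rightarrow> complex"
  assumes "holomorphic_Cn_on f S" "z \<in> S"
  shows "(f has_derivative D1 f z) (at z)"
proof -
  obtain f' where f': "(f has_derivative f') (at z)" and lin: "\<And>c v. f' (c *s v) = c * f' v"
    using assms unfolding holomorphic_Cn_on_def by blast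
  have pd: "partial_deriv j f z = f' (axis j 1)" for j
  proof -
    have "((\<lambda>t. z + t *s axis j 1) has_derivative (\<lambda>t. t *s axis j 1)) (at 0)"
      by (auto intro!: derivative_eq_intros bounded_linear.has_derivative[OF bounded_linear_smult_left])
    from has_derivative_compose[OF this, of f f'] f'
    have "((\<lambda>t. f (z + t *s axis j 1)) has_derivative (\<lambda>t. f' (t *s axis j 1))) (at 0)"
      by simp
    then have "((\<lambda>t. f (z + t *s axis j 1)) has_field_derivative f' (axis j 1)) (at 0)"
      unfolding has_field_derivative_def lin by (simp add: mult_commute_abs)
    then show ?thesis
      unfolding partial_deriv_def by (rule DERIV_imp_deriv)
  qed
  interpret f': bounded_linear f' using f' by (rule has_derivative_bounded_linear)
  have "f' = D1 f z"
  proof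
    fix v
    have "f' v = f' (\<Sum>j\<in>UNIV. v $ j *s axis j 1)" by (simp add: basis_expansion)
    also have "\<dots> = D1 f z v"
      by (simp add: f'.sum lin D1_def pd mult.commute)
    finally show "f' v = D1 f z v" .
  qed
  then show ?thesis using f' by simp
qed

lemma DERIV_holomorphic_Cn_compose:
  fixes \<phi> :: "'n::finite \<Rightarrow> complex \<Rightarrow> complex"
  assumes f: "holomorphic_Cn_on f S" "(\<chi> j. \<phi> j z) \<in> S"
    and \<phi>: "\<And>j. (\<phi> j has_field_derivative \<phi>' $ j) (at z)"
  shows "((\<lambda>z. f (\<chi> j. \<phi> j z)) has_field_derivative D1 f (\<chi> j. \<phi> j z) \<phi>') (at z)"
proof -
  have expand: "(\<chi> j. \<psi> j) = (\<Sum>j\<in>UNIV. \<psi> j *s axis j 1)" for \<psi> :: "'n \<Rightarrow> complex"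
    using basis_expansion[of "\<chi> j. \<psi> j"] by simp
  have "((\<lambda>z. \<Sum>j\<in>UNIV. \<phi> j z *s (axis j 1 :: complex ^ 'n)) has_derivative
      (\<lambda>h. \<Sum>j\<in>UNIV. (\<phi>' $ j * h) *s axis j 1)) (at z)"
    using \<phi> unfolding has_field_derivative_def
    by (intro has_derivative_sum bounded_linear.has_derivative[OF bounded_linear_smult_left])
  also have "(\<lambda>h. \<Sum>j\<in>UNIV. (\<phi>' $ j * h) *s axis j 1) = (\<lambda>h. h *s \<phi>')"
  proof
    fix h
    show "(\<Sum>j\<in>UNIV. (\<phi>' $ j * h) *s axis j 1) = h *s \<phi>'"
      unfolding expand[symmetric] by (simp add: vec_eq_iff)
  qed
  finally have "((\<lambda>z. \<chi> j. \<phi> j z) has_derivative (\<lambda>h. h *s \<phi>')) (at z)"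
    unfolding expand .
  from has_derivative_compose[OF this holomorphic_Cn_has_derivative_D1[OF f]]
  show ?thesis
    unfolding has_field_derivative_def D1_smult by (simp add: mult_commute_abs)
qed

lemma DERIV_holomorphic_Cn_line:
  fixes f :: "complex ^ 'n \<Rightarrow> complex"
  assumes "holomorphic_Cn_on f S" "z + t *s v \<in> S"
  shows "((\<lambda>t. f (z + t *s v)) has_field_derivative D1 f (z + t *s v) v) (at t)"
proof -
  have eq: "z + t *s v = (\<chi> j. z $ j + t * v $ j)" for t by (simp add: vec_eq_iff)
  show ?thesis
    using assms unfolding eq
    by (intro DERIV_holomorphic_Cn_compose) (auto intro!: derivative_eq_intros)
qed

lemma holomorphic_on_line:
  fixes f :: "complex ^ 'n \<Rightarrow> complex"
  assumes "holomorphic_Cn_on f S" "\<And>t. t \<in> U \<Longrightarrow> z + t *s v \<in> S"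
  shows "(\<lambda>t. f (z + t *s v)) holomorphic_on U"
  unfolding holomorphic_on_def field_differentiable_def
  using DERIV_holomorphic_Cn_line[OF assms(1)] assms(2) has_field_derivative_at_within by blast

text \<open>Taylor's formula on the unit disc, with the second derivative bounded by the Cauchy
  inequality on discs of radius \<open>R / 4\<close>; these stay inside the disc of radius \<open>R\<close> since
  \<open>1 + R / 4 < R\<close>, and \<open>2 M / (R / 4)\<^sup>2 = 32 M / R\<^sup>2\<close>.\<close>

lemma holomorphic_second_order_estimate:
  fixes g :: "complex \<Rightarrow> complex"
  assumes g: "g holomorphic_on ball 0 R" and R: "2 \<le> R"
    and M: "\<And>z. z \<in> ball 0 R \<Longrightarrow> cmod (g z) \<le> M"
  shows "cmod (g 1 - g 0 - deriv g 0) \<le> 32 * M / R\<^sup>2"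
proof -
  have der: "((deriv ^^ i) g has_field_derivative (deriv ^^ Suc i) g x) (at x within cball 0 1)"
    if "x \<in> cball 0 1" for i x
  proof -
    have "(deriv ^^ i) g holomorphic_on ball 0 R"
      by (intro holomorphic_higher_deriv g open_ball)
    then show ?thesis
      using that R holomorphic_derivI[of "(deriv ^^ i) g" "ball 0 R" x]
      by (auto intro: has_field_derivative_at_within)
  qed
  have bound: "cmod ((deriv ^^ Suc 1) g x) \<le> 32 * M / R\<^sup>2" if x: "x \<in> cball 0 1" for x
  proof -
    have sub: "cball x (R / 4) \<subseteq> ball 0 R"
    proof
      fix y assume y: "y \<in> cball x (R / 4)"
      have "cmod y \<le> cmod x + dist x y"
        by (metis dist_norm norm_minus_commute norm_triangle_sub)
      then show "y \<in> ball 0 R" using x y R by simp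
    qed
    have "cmod ((deriv ^^ 2) g x) \<le> fact 2 * M / (R / 4) ^ 2"
    proof (rule Cauchy_inequality)
      show "g holomorphic_on ball x (R / 4)"
        using sub ball_subset_cball by (blast intro: holomorphic_on_subset[OF g])
      show "continuous_on (cball x (R / 4)) g"
        by (rule holomorphic_on_imp_continuous_on[OF holomorphic_on_subset[OF g sub]])
      show "cmod (g y) \<le> M" if "cmod (x - y) = R / 4" for y
        using that sub by (intro M) (auto simp: dist_norm)
    qed (use R in simp)
    then show ?thesis by (simp add: numeral_2_eq_2 power2_eq_square)
  qed
  have "cmod ((deriv ^^ 0) g 1 - (\<Sum>i\<le>1. (deriv ^^ i) g 0 * (1 - 0) ^ i / fact i))
      \<le> 32 * M / R\<^sup>2 * cmod (1 - 0) ^ Suc 1 / fact 1"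
    by (rule complex_Taylor[where S = "cball 0 1"]) (use der bound in auto)
  then show ?thesis by (simp add: diff_diff_eq)
qed

text \<open>The one-variable estimate along the complex line through \<open>w\<close> in direction \<open>h\<close>.  The constant
  depends on neither \<open>w\<close> nor \<open>h\<close>, and this uniformity makes the difference quotients
  of \<open>f\<close> converge locally uniformly.\<close>

lemma holomorphic_Cn_second_order_estimate:
  fixes f :: "complex ^ 'n \<Rightarrow> complex"
  assumes f: "holomorphic_Cn_on f S" and sub: "ball w \<delta> \<subseteq> S" and \<delta>: "0 < \<delta>"
    and M: "\<And>z. z \<in> ball w \<delta> \<Longrightarrow> cmod (f z) \<le> M" and h: "norm h \<le> \<delta> / 2"
  shows "cmod (f (w + h) - f w - D1 f w h) \<le> 32 * M / \<delta>\<^sup>2 * (norm h)\<^sup>2"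
proof (cases "h = 0")
  case True
  then show ?thesis by (simp add: D1_def)
next
  case False
  define R where "R = \<delta> / norm h"
  have R: "2 \<le> R" using False h by (simp add: R_def field_simps)
  have in_ball: "w + t *s h \<in> ball w \<delta>" if "t \<in> ball 0 R" for t
    using that False by (simp add: R_def dist_norm norm_smult_complex field_simps)
  define g where "g = (\<lambda>t. f (w + t *s h))"
  have "cmod (g 1 - g 0 - deriv g 0) \<le> 32 * M / R\<^sup>2"
  proof (rule holomorphic_second_order_estimate[OF _ R])
    show "g holomorphic_on ball 0 R"
      unfolding g_def using in_ball sub by (intro holomorphic_on_line[OF f]) blast
    show "cmod (g z) \<le> M" if "z \<in> ball 0 R" for z
      unfolding g_def by (rule M[OF in_ball[OF that]])
  qed
  moreover have "deriv g 0 = D1 f w h"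
  proof -
    have "w \<in> S" using sub \<delta> by auto
    then show ?thesis
      using DERIV_holomorphic_Cn_line[OF f, of w 0 h] by (simp add: g_def DERIV_imp_deriv)
  qed
  ultimately show ?thesis
    by (simp add: g_def R_def power_divide)
qed

text \<open>By the previous estimate the partial derivative is a uniform limit of the difference
  quotients \<open>(f (w + \<epsilon> e\<^sub>j) - f w) / \<epsilon>\<close>, which are holomorphic along the line.\<close>

lemma holomorphic_partial_deriv_line:
  fixes f :: "complex ^ 'n \<Rightarrow> complex"
  assumes f: "holomorphic_Cn_on f S" and sub: "ball z (2 * \<delta>) \<subseteq> S" and \<delta>: "0 < \<delta>"
    and M: "\<And>w. w \<in> ball z (2 * \<delta>) \<Longrightarrow> cmod (f w) \<le> M" and v: "norm v \<le> 1"
  shows "(\<lambda>t. partial_deriv j f (z + t *s v)) holomorphic_on ball 0 \<delta>"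
proof -
  define \<epsilon> where "\<epsilon> = (\<lambda>n. \<delta> / 2 / real (Suc n))"
  have \<epsilon>: "0 < \<epsilon> n" "\<epsilon> n \<le> \<delta> / 2" for n
    using \<delta> by (simp_all add: \<epsilon>_def field_simps)
  have \<epsilon>_lim: "\<epsilon> \<longlonglongrightarrow> 0"
    unfolding \<epsilon>_def by (rule real_tendsto_divide_at_top[OF tendsto_const])
      (rule filterlim_compose[OF filterlim_real_sequentially filterlim_Suc])
  have tv: "norm (t *s v) < \<delta>" if "t \<in> ball 0 \<delta>" for t
    using that v by (simp add: norm_smult_complex)
      (metis mult_right_le_one_le norm_ge_zero order_le_less_trans)
  define f' where "f' = (\<lambda>n t. (f (z + t *s v + of_real (\<epsilon> n) *s axis j 1) - f (z + t *s v)) / of_real (\<epsilon> n))"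
  have f'_hol: "f' n holomorphic_on ball 0 \<delta>" for n
  proof -
    have "(\<lambda>t. f (z + of_real (\<epsilon> n) *s axis j 1 + t *s v)) holomorphic_on ball 0 \<delta>"
    proof (rule holomorphic_on_line[OF f])
      fix t :: complex assume "t \<in> ball 0 \<delta>"
      then have "norm (of_real (\<epsilon> n) *s axis j 1 + t *s v) < 2 * \<delta>"
        using norm_triangle_ineq[of "of_real (\<epsilon> n) *s axis j 1" "t *s v"] tv[of t] \<epsilon>[of n] \<delta>
        by (simp add: norm_smult_complex norm_axis_complex)
      then have "z + (of_real (\<epsilon> n) *s axis j 1 + t *s v) \<in> ball z (2 * \<delta>)"
        unfolding mem_ball dist_commute[of z] by (simp add: dist_norm)
      then show "z + of_real (\<epsilon> n) *s axis j 1 + t *s v \<in> S"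
        using sub by (auto simp: add.assoc)
    qed
    moreover have "(\<lambda>t. f (z + t *s v)) holomorphic_on ball 0 \<delta>"
    proof (rule holomorphic_on_line[OF f])
      fix t :: complex assume "t \<in> ball 0 \<delta>"
      then have "z + t *s v \<in> ball z (2 * \<delta>)" using tv[of t] \<delta> by (simp add: dist_norm)
      then show "z + t *s v \<in> S" using sub by auto
    qed
    ultimately show ?thesis
      unfolding f'_def using \<epsilon>(1)[of n]
      by (intro holomorphic_intros) (auto simp: add_ac)
  qed
  have close: "dist (f' n t) (partial_deriv j f (z + t *s v)) \<le> 32 * M / \<delta>\<^sup>2 * \<epsilon> n"
    if t: "t \<in> ball 0 \<delta>" for n t
  proof -
    define w where "w = z + t *s v"
    have wsub: "ball w \<delta> \<subseteq> ball z (2 * \<delta>)"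
    proof
      fix y assume "y \<in> ball w \<delta>"
      moreover have "dist z w < \<delta>" using tv[OF t] by (simp add: w_def dist_norm)
      ultimately show "y \<in> ball z (2 * \<delta>)"
        using dist_triangle[of z y w] by simp
    qed
    have "cmod (f (w + of_real (\<epsilon> n) *s axis j 1) - f w - D1 f w (of_real (\<epsilon> n) *s axis j 1))
        \<le> 32 * M / \<delta>\<^sup>2 * (norm (of_real (\<epsilon> n) *s axis j 1 :: complex ^ 'n))\<^sup>2"
      by (rule holomorphic_Cn_second_order_estimate[OF f _ \<delta>])
        (use wsub sub M \<epsilon>[of n] in \<open>auto simp: norm_smult_complex norm_axis_complex\<close>)
    then have "cmod (f (w + of_real (\<epsilon> n) *s axis j 1) - f w - \<epsilon> n * partial_deriv j f w)
        \<le> 32 * M / \<delta>\<^sup>2 * \<epsilon> n * \<epsilon> n"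
      using \<epsilon>(1)[of n]
      by (simp add: norm_smult_complex norm_axis_complex D1_smult D1_axis power2_eq_square)
    moreover have "f' n t - partial_deriv j f w
        = (f (w + of_real (\<epsilon> n) *s axis j 1) - f w - \<epsilon> n * partial_deriv j f w) / \<epsilon> n"
      using \<epsilon>(1)[of n] by (simp add: f'_def w_def field_simps)
    ultimately show ?thesis
      using \<epsilon>(1)[of n] unfolding w_def[symmetric]
      by (simp add: dist_norm norm_divide divide_le_eq)
  qed
  have unif: "uniform_limit (ball 0 \<delta>) f' (\<lambda>t. partial_deriv j f (z + t *s v)) sequentially"
  proof (rule uniform_limitI)
    fix e :: real assume e: "0 < e"
    have "(\<lambda>n. 32 * M / \<delta>\<^sup>2 * \<epsilon> n) \<longlonglongrightarrow> 0"
      using tendsto_mult[OF tendsto_const \<epsilon>_lim, of "32 * M / \<delta>\<^sup>2"] by simp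
    then have "\<forall>\<^sub>F n in sequentially. 32 * M / \<delta>\<^sup>2 * \<epsilon> n < e"
      using e by (rule order_tendstoD)
    then show "\<forall>\<^sub>F n in sequentially. \<forall>t\<in>ball 0 \<delta>. dist (f' n t) (partial_deriv j f (z + t *s v)) < e"
      by eventually_elim (use close order_le_less_trans in blast)
  qed
  show ?thesis
  proof (rule holomorphic_uniform_sequence[OF open_ball f'_hol])
    fix x :: complex assume "x \<in> ball 0 \<delta>"
    then obtain d where "0 < d" "cball x d \<subseteq> ball 0 \<delta>"
      using open_contains_cball[of "ball 0 \<delta>"] by (metis open_ball)
    then show "\<exists>d>0. cball x d \<subseteq> ball 0 \<delta> \<and>
        uniform_limit (cball x d) f' (\<lambda>t. partial_deriv j f (z + t *s v)) sequentially"
      using uniform_limit_on_subset[OF unif] by blast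
  qed
qed

lemma has_derivative_quadratic_remainder:
  fixes g :: "'a::real_normed_vector \<Rightarrow> 'b::real_normed_vector"
  assumes L: "bounded_linear L" and r: "0 < r"
    and bound: "\<And>h. norm h \<le> r \<Longrightarrow> norm (g (z + h) - g z - L h) \<le> C * (norm h)\<^sup>2"
  shows "(g has_derivative L) (at z)"
  unfolding has_derivative_at
proof (intro conjI L)
  have ev: "\<forall>\<^sub>F h in at 0. norm (norm (g (z + h) - g z - L h) / norm h) \<le> C * norm h"
    unfolding eventually_at
  proof (intro exI[of _ r] conjI r ballI impI)
    fix h :: 'a assume "h \<noteq> 0 \<and> dist h 0 < r"
    then show "norm (norm (g (z + h) - g z - L h) / norm h) \<le> C * norm h"
      using bound[of h] by (simp add: divide_le_eq power2_eq_square mult.assoc)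
  qed
  have "((\<lambda>h::'a. C * norm h) \<longlongrightarrow> C * norm (0::'a)) (at 0)"
    by (intro tendsto_intros)
  then show "(\<lambda>h. norm (g (z + h) - g z - L h) / norm h) \<midarrow>0\<rightarrow> 0"
    by (intro Lim_null_comparison[OF ev]) simp
qed

text \<open>Complex differentiability gives no continuity of the partial derivatives directly, so the
  derivative of a partial derivative is found through Cauchy's inequality: the first-order Taylor
  remainder of \<open>f\<close> with increment \<open>h\<close>, taken at the base point \<open>z + t e\<^sub>k\<close>, is holomorphic in \<open>t\<close> and
  uniformly of size \<open>O(|h|\<^sup>2)\<close>, and hence so is its \<open>t\<close>-derivative at 0.  That derivative is
  the first-order remainder of the \<open>k\<close>-th partial derivative, with the linear part
  \<open>\<Sum>\<^sub>j \<partial>\<^sub>k \<partial>\<^sub>j f(z) h\<^sub>j\<close>.\<close>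

theorem holomorphic_Cn_partial_deriv:
  fixes f :: "complex ^ 'n \<Rightarrow> complex"
  assumes f: "holomorphic_Cn_on f S" and S: "open S"
  shows "holomorphic_Cn_on (partial_deriv k f) S"
  unfolding holomorphic_Cn_on_def
proof
  fix z assume z: "z \<in> S"
  obtain \<rho> where \<rho>: "0 < \<rho>" "cball z \<rho> \<subseteq> S"
    using S z open_contains_cball by blast
  define \<delta> where "\<delta> = \<rho> / 2"
  have \<delta>: "0 < \<delta>" and sub: "cball z (2 * \<delta>) \<subseteq> S" using \<rho> by (simp_all add: \<delta>_def)
  have "continuous_on (cball z (2 * \<delta>)) f"
    using holomorphic_Cn_has_derivative_D1[OF f] sub
    by (meson continuous_at_imp_continuous_on has_derivative_continuous subsetD)
  then have "bounded (f ` cball z (2 * \<delta>))"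
    by (intro compact_imp_bounded compact_continuous_image compact_cball)
  then obtain M where M: "\<And>w. w \<in> cball z (2 * \<delta>) \<Longrightarrow> cmod (f w) \<le> M"
    unfolding bounded_iff by blast
  define L where "L = (\<lambda>h. \<Sum>j\<in>UNIV. partial_deriv k (partial_deriv j f) z * h $ j)"
  have L: "bounded_linear L"
    unfolding L_def
    by (intro bounded_linear_sum bounded_linear_const_mult bounded_linear_vec_nth)
  have pd_hol: "(\<lambda>t. partial_deriv j f (z + t *s axis k 1)) holomorphic_on ball 0 \<delta>" for j
    by (rule holomorphic_partial_deriv_line[OF f _ \<delta>, where M = M])
      (use sub M ball_subset_cball in \<open>auto simp: norm_axis_complex\<close>)
  have bound: "cmod (partial_deriv k f (z + h) - partial_deriv k f z - L h)
      \<le> 32 * M / \<delta>\<^sup>2 / (\<delta> / 2) * (norm h)\<^sup>2" if h: "norm h \<le> \<delta> / 2" for h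
  proof -
    have in_ball: "z + t *s axis k 1 \<in> ball z \<delta>" if "t \<in> ball 0 \<delta>" for t :: complex
      using that by (simp add: dist_norm norm_smult_complex norm_axis_complex)
    have ball_sub: "ball w \<delta> \<subseteq> cball z (2 * \<delta>)" if "w \<in> ball z \<delta>" for w
    proof
      fix y assume "y \<in> ball w \<delta>"
      then show "y \<in> cball z (2 * \<delta>)"
        using that dist_triangle[of z y w] by simp
    qed
    define H where "H = (\<lambda>t. f (z + h + t *s axis k 1) - f (z + t *s axis k 1)
        - D1 f (z + t *s axis k 1) h)"
    have hol1: "(\<lambda>t. f (z + h + t *s axis k 1)) holomorphic_on ball 0 \<delta>"
    proof (rule holomorphic_on_line[OF f])
      fix t :: complex assume "t \<in> ball 0 \<delta>"
      then have "z + t *s axis k 1 + h \<in> ball (z + t *s axis k 1) \<delta>"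
        using h \<delta> by (simp add: dist_norm)
      then have "z + t *s axis k 1 + h \<in> S"
        using ball_sub[OF in_ball[OF \<open>t \<in> ball 0 \<delta>\<close>]] sub by blast
      then show "z + h + t *s axis k 1 \<in> S" by (simp add: add_ac)
    qed
    have hol2: "(\<lambda>t. f (z + t *s axis k 1)) holomorphic_on ball 0 \<delta>"
    proof (rule holomorphic_on_line[OF f])
      fix t :: complex assume "t \<in> ball 0 \<delta>"
      from in_ball[OF this] show "z + t *s axis k 1 \<in> S"
        using sub \<delta> by auto
    qed
    have H_hol: "H holomorphic_on ball 0 \<delta>"
      unfolding H_def D1_def by (intro holomorphic_intros hol1 hol2 pd_hol)
    have H_bound: "cmod (H t) \<le> 32 * M / \<delta>\<^sup>2 * (norm h)\<^sup>2" if t: "t \<in> ball 0 \<delta>" for t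
    proof -
      have "cmod (f (z + t *s axis k 1 + h) - f (z + t *s axis k 1) - D1 f (z + t *s axis k 1) h)
          \<le> 32 * M / \<delta>\<^sup>2 * (norm h)\<^sup>2"
        by (rule holomorphic_Cn_second_order_estimate[OF f _ \<delta> _ h])
          (use ball_sub[OF in_ball[OF t]] sub M in auto)
      then show ?thesis by (simp add: H_def add_ac)
    qed
    have "cmod ((deriv ^^ 1) H 0) \<le> fact 1 * (32 * M / \<delta>\<^sup>2 * (norm h)\<^sup>2) / (\<delta> / 2) ^ 1"
    proof (rule Cauchy_inequality)
      show "H holomorphic_on ball 0 (\<delta> / 2)" "continuous_on (cball 0 (\<delta> / 2)) H"
        using \<delta> by (auto intro!: holomorphic_on_imp_continuous_on holomorphic_on_subset[OF H_hol])
    qed (use \<delta> H_bound in auto)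
    moreover have "deriv H 0 = partial_deriv k f (z + h) - partial_deriv k f z - L h"
    proof (rule DERIV_imp_deriv)
      note D = holomorphic_derivI[OF _ open_ball, of _ 0 \<delta> 0]
      show "(H has_field_derivative (partial_deriv k f (z + h) - partial_deriv k f z - L h)) (at 0)"
        unfolding H_def D1_def L_def partial_deriv_def[of k]
        by (intro DERIV_diff DERIV_sum DERIV_cmult_right D hol1 hol2 pd_hol) (use \<delta> in auto)
    qed
    ultimately show ?thesis by simp
  qed
  have "(partial_deriv k f has_derivative L) (at z)"
    by (rule has_derivative_quadratic_remainder[OF L, where r = "\<delta> / 2", OF _ bound]) (use \<delta> in auto)
  moreover have "L (c *s v) = c * L v" for c v
    by (simp add: L_def sum_distrib_left mult_ac)
  ultimately show "\<exists>f'. (partial_deriv k f has_derivative f') (at z) \<and> (\<forall>c v. f' (c *s v) = c * f' v)"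
    by blast
qed

theorem deriv2_holomorphic_Cn_compose:
  fixes \<phi> :: "'n::finite \<Rightarrow> complex \<Rightarrow> complex"
  assumes f: "holomorphic_Cn_on f S" and S: "open S"
    and \<phi>: "\<And>j. \<phi> j holomorphic_on U" and U: "open U" and z: "z \<in> U"
    and sub: "\<And>z. z \<in> U \<Longrightarrow> (\<chi> j. \<phi> j z) \<in> S"
  shows "deriv (deriv (\<lambda>z. f (\<chi> j. \<phi> j z))) z =
    D2 f (\<chi> j. \<phi> j z) (\<chi> j. deriv (\<phi> j) z) + D1 f (\<chi> j. \<phi> j z) (\<chi> j. deriv (deriv (\<phi> j)) z)"
proof -
  have D\<phi>: "(\<phi> j has_field_derivative deriv (\<phi> j) x) (at x)" if "x \<in> U" for x j
    by (rule holomorphic_derivI[OF \<phi> U that])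
  have "deriv (\<lambda>z. f (\<chi> j. \<phi> j z)) x =
      (\<Sum>k\<in>UNIV. partial_deriv k f (\<chi> j. \<phi> j x) * deriv (\<phi> k) x)" if "x \<in> U" for x
  proof -
    have "deriv (\<lambda>z. f (\<chi> j. \<phi> j z)) x = D1 f (\<chi> j. \<phi> j x) (\<chi> j. deriv (\<phi> j) x)"
      by (rule DERIV_imp_deriv, rule DERIV_holomorphic_Cn_compose[OF f])
        (simp_all add: sub D\<phi> that)
    then show ?thesis by (simp add: D1_def)
  qed
  then have "\<forall>\<^sub>F x in nhds z. deriv (\<lambda>z. f (\<chi> j. \<phi> j z)) x =
      (\<Sum>k\<in>UNIV. partial_deriv k f (\<chi> j. \<phi> j x) * deriv (\<phi> k) x)"
    using U z by (auto simp: eventually_nhds)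
  then have "deriv (deriv (\<lambda>z. f (\<chi> j. \<phi> j z))) z =
      deriv (\<lambda>x. \<Sum>k\<in>UNIV. partial_deriv k f (\<chi> j. \<phi> j x) * deriv (\<phi> k) x) z"
    by (rule deriv_cong_ev) simp
  also have "\<dots> = (\<Sum>k\<in>UNIV. D1 (partial_deriv k f) (\<chi> j. \<phi> j z) (\<chi> j. deriv (\<phi> j) z) * deriv (\<phi> k) z
      + deriv (deriv (\<phi> k)) z * partial_deriv k f (\<chi> j. \<phi> j z))"
  proof (rule DERIV_imp_deriv, intro DERIV_sum DERIV_mult)
    show "(deriv (\<phi> k) has_field_derivative deriv (deriv (\<phi> k)) z) (at z)" for k
      by (rule holomorphic_derivI[OF holomorphic_deriv[OF \<phi> U] U z])
    show "((\<lambda>x. partial_deriv k f (\<chi> j. \<phi> j x)) has_field_derivative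
        D1 (partial_deriv k f) (\<chi> j. \<phi> j z) (\<chi> j. deriv (\<phi> j) z)) (at z)" for k
      by (rule DERIV_holomorphic_Cn_compose[OF holomorphic_Cn_partial_deriv[OF f S]])
        (simp_all add: sub D\<phi> z)
  qed
  also have "\<dots> = D2 f (\<chi> j. \<phi> j z) (\<chi> j. deriv (\<phi> j) z)
      + D1 f (\<chi> j. \<phi> j z) (\<chi> j. deriv (deriv (\<phi> j)) z)"
  proof -
    have "(\<Sum>k\<in>UNIV. D1 (partial_deriv k f) (\<chi> j. \<phi> j z) (\<chi> j. deriv (\<phi> j) z) * deriv (\<phi> k) z)
        = D2 f (\<chi> j. \<phi> j z) (\<chi> j. deriv (\<phi> j) z)"
      unfolding D2_def D1_def sum_distrib_right by (subst sum.swap) (simp add: mult_ac)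
    then show ?thesis
      by (simp add: sum.distrib D1_def mult.commute)
  qed
  finally show ?thesis .
qed

section \<open>The homomorphism on the polydisc\<close>

lemma open_polydisc: "open (polydisc :: (complex ^ 'n) set)"
proof -
  have eq: "polydisc = (\<Inter>j. (\<lambda>z :: complex ^ 'n. z $ j) -` ball 0 1)"
    by (auto simp: polydisc_def)
  show ?thesis
    unfolding eq by (intro open_INT ballI open_vimage open_ball continuous_intros) simp
qed

lemma H_inf_const: "(\<lambda>z. c) \<in> H_inf"
  by (auto simp: H_inf_def holomorphic_Cn_on_def image_constant_conv intro!: exI[of _ "\<lambda>h. 0"])

lemma H_inf_coordinate: "(\<lambda>z. z $ j) \<in> H_inf"
proof -
  have "holomorphic_Cn_on (\<lambda>z. z $ j) polydisc"
    unfolding holomorphic_Cn_on_def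
    by (auto intro!: exI[of _ "\<lambda>h. h $ j"] bounded_linear_imp_has_derivative bounded_linear_vec_nth)
  moreover have "bounded ((\<lambda>z. z $ j) ` polydisc)"
    unfolding bounded_iff by (auto simp: polydisc_def intro!: exI[of _ 1] less_imp_le)
  ultimately show ?thesis by (simp add: H_inf_def)
qed

lemma H_inf_add:
  assumes "f \<in> H_inf" "g \<in> H_inf"
  shows "(\<lambda>z. f z + g z) \<in> H_inf"
proof -
  have "holomorphic_Cn_on (\<lambda>z. f z + g z) polydisc"
    unfolding holomorphic_Cn_on_def
  proof
    fix z :: "complex ^ 'a" assume "z \<in> polydisc"
    then obtain f' g' where "(f has_derivative f') (at z)" "(g has_derivative g') (at z)"
      "\<forall>c v. f' (c *s v) = c * f' v" "\<forall>c v. g' (c *s v) = c * g' v"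
      using assms unfolding H_inf_def holomorphic_Cn_on_def by blast
    then show "\<exists>h. ((\<lambda>z. f z + g z) has_derivative h) (at z) \<and> (\<forall>c v. h (c *s v) = c * h v)"
      by (intro exI[of _ "\<lambda>v. f' v + g' v"]) (auto intro: has_derivative_add simp: algebra_simps)
  qed
  moreover have "bounded ((\<lambda>z. f z + g z) ` polydisc)"
    using assms by (intro bounded_plus_comp) (auto simp: H_inf_def)
  ultimately show ?thesis by (simp add: H_inf_def)
qed

lemma H_inf_mult:
  assumes "f \<in> H_inf" "g \<in> H_inf"
  shows "(\<lambda>z. f z * g z) \<in> H_inf"
proof -
  have "holomorphic_Cn_on (\<lambda>z. f z * g z) polydisc"
    unfolding holomorphic_Cn_on_def
  proof
    fix z :: "complex ^ 'a" assume "z \<in> polydisc"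
    then obtain f' g' where "(f has_derivative f') (at z)" "(g has_derivative g') (at z)"
      "\<forall>c v. f' (c *s v) = c * f' v" "\<forall>c v. g' (c *s v) = c * g' v"
      using assms unfolding H_inf_def holomorphic_Cn_on_def by blast
    then show "\<exists>h. ((\<lambda>z. f z * g z) has_derivative h) (at z) \<and> (\<forall>c v. h (c *s v) = c * h v)"
      by (intro exI[of _ "\<lambda>v. f z * g' v + f' v * g z"])
         (auto intro: has_derivative_mult simp: algebra_simps)
  qed
  moreover have "bounded ((\<lambda>z. f z * g z) ` polydisc)"
  proof -
    obtain A B where A: "\<And>z. z \<in> polydisc \<Longrightarrow> cmod (f z) \<le> A"
      and B: "\<And>z. z \<in> polydisc \<Longrightarrow> cmod (g z) \<le> B"
      using assms unfolding H_inf_def bounded_iff by blast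
    have "cmod (f z * g z) \<le> A * B" if "z \<in> polydisc" for z
      unfolding norm_mult by (rule mult_mono') (simp_all add: A B that)
    then show ?thesis unfolding bounded_iff by blast
  qed
  ultimately show ?thesis by (simp add: H_inf_def)
qed

lemma upper_toeplitz_add:
  "upper_toeplitz a b c + upper_toeplitz a' b' c' = upper_toeplitz (a + a') (b + b') (c + c')"
  by (simp add: upper_toeplitz_def vec_eq_iff forall_3)

lemma upper_toeplitz_mult:
  "upper_toeplitz a b c ** upper_toeplitz a' b' c' =
     upper_toeplitz (a * a') (a * b' + b * a') (a * c' + b * b' + c * a')"
  by (simp add: upper_toeplitz_def vec_eq_iff forall_3 matrix_matrix_mult_def sum_3 algebra_simps)

lemma mat_eq_upper_toeplitz: "mat c = upper_toeplitz c 0 0"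
  by (simp add: upper_toeplitz_def vec_eq_iff forall_3 mat_def)

text \<open>Along a curve in the polydisc whose second-order jet is \<open>\<omega> + \<alpha> z\<close>, the second-order jet of \<open>f\<close>
  becomes that of a function of one variable.  The vanishing second derivative of the curve
  removes the term \<open>Df(\<omega>) \<phi>''(0)\<close> from the chain rule.\<close>

lemma rho_eq_upper_toeplitz_compose:
  fixes \<phi> :: "'n::finite \<Rightarrow> complex \<Rightarrow> complex"
  assumes f: "f \<in> H_inf"
    and \<phi>: "\<And>j. \<phi> j holomorphic_on ball 0 1"
    and disc: "\<And>j z. z \<in> ball 0 1 \<Longrightarrow> cmod (\<phi> j z) < 1"
    and jet: "\<And>j. \<phi> j 0 = \<omega> $ j" "\<And>j. deriv (\<phi> j) 0 = \<alpha> $ j" "\<And>j. deriv (deriv (\<phi> j)) 0 = 0"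
  defines "F \<equiv> \<lambda>z. f (\<chi> j. \<phi> j z)"
  shows "F holomorphic_on ball 0 1"
    and "rho \<omega> \<alpha> f = upper_toeplitz (F 0) (deriv F 0) (deriv (deriv F) 0 / 2)"
proof -
  have hol: "holomorphic_Cn_on f polydisc" using f by (simp add: H_inf_def)
  have sub: "(\<chi> j. \<phi> j z) \<in> polydisc" if "z \<in> ball 0 1" for z
    using disc[OF that] by (simp add: polydisc_def)
  have DF: "(F has_field_derivative D1 f (\<chi> j. \<phi> j z) (\<chi> j. deriv (\<phi> j) z)) (at z)"
    if "z \<in> ball 0 1" for z
    unfolding F_def
    by (rule DERIV_holomorphic_Cn_compose[OF hol])
      (use that sub in \<open>auto intro: holomorphic_derivI[OF \<phi>]\<close>)
  then show "F holomorphic_on ball 0 1"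
    unfolding holomorphic_on_open[OF open_ball] by blast
  have "deriv F 0 = D1 f \<omega> \<alpha>"
    using DERIV_imp_deriv[OF DF[of 0]] by (simp add: jet)
  moreover have "deriv (deriv F) 0 = D2 f \<omega> \<alpha>"
    using deriv2_holomorphic_Cn_compose[OF hol open_polydisc \<phi> open_ball _ sub, of 0]
    by (simp add: F_def jet D1_def)
  ultimately show "rho \<omega> \<alpha> f = upper_toeplitz (F 0) (deriv F 0) (deriv (deriv F) 0 / 2)"
    by (simp add: rho_def F_def jet)
qed

text \<open>Each contraction \<open>T\<^sub>j\<close> provides one coordinate \<open>\<phi>\<^sub>j\<close> of the curve.  The homomorphism property
  is then the arithmetic of Taylor coefficients of the functions \<open>f \<circ> \<phi>\<close>, and contractivity is
  that of the truncated Toeplitz matrices of these functions.\<close>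

theorem theorem2p12:
  fixes \<omega> \<alpha> :: "complex ^ 'n"
  assumes "\<omega> \<in> polydisc"
    and "\<And>j. matrix_norm (T_mat \<omega> \<alpha> j) \<le> 1"
  shows "hom_induced_by (T_mat \<omega> \<alpha>) (rho \<omega> \<alpha>) \<and>
    (\<forall>f\<in>H_inf. matrix_norm (rho \<omega> \<alpha> f) \<le> polydisc_norm f)"
proof -
  have "\<exists>E. E holomorphic_on ball 0 1 \<and>
      (\<forall>z\<in>ball 0 1. cmod (\<omega> $ j + \<alpha> $ j * z + z ^ 3 * E z) < 1)" for j
  proof -
    have w: "cmod (\<omega> $ j) < 1" using assms(1) by (simp add: polydisc_def)
    have "(cmod (\<alpha> $ j))\<^sup>2 \<le> (1 - cmod (\<omega> $ j)) * (1 - (cmod (\<omega> $ j))\<^sup>2)"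
      using assms(2)[of j] w unfolding T_mat_def by (rule upper_toeplitz_contraction_bound)
    with w obtain E where "E holomorphic_on ball 0 1"
      "\<And>z. z \<in> ball 0 1 \<Longrightarrow> cmod (\<omega> $ j + \<alpha> $ j * z + z ^ 3 * E z) < 1"
      using Schur_interpolation by blast
    then show ?thesis by blast
  qed
  then obtain E where E: "\<And>j. E j holomorphic_on ball 0 1"
    and E_disc: "\<And>j z. z \<in> ball 0 1 \<Longrightarrow> cmod (\<omega> $ j + \<alpha> $ j * z + z ^ 3 * E j z) < 1"
    by metis
  define \<phi> where "\<phi> = (\<lambda>j z. \<omega> $ j + \<alpha> $ j * z + z ^ 3 * E j z)"
  have \<phi>: "\<phi> j holomorphic_on ball 0 1" for j
    unfolding \<phi>_def by (intro holomorphic_intros E)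
  have disc: "cmod (\<phi> j z) < 1" if "z \<in> ball 0 1" for j z
    using E_disc[OF that] by (simp add: \<phi>_def)
  \<comment> \<open>The factor \<open>z\<^sup>2\<close> makes the second derivative vanish at 0.\<close>
  have D\<phi>: "deriv (\<phi> j) z = \<alpha> $ j + z\<^sup>2 * (3 * E j z + z * deriv (E j) z)"
    if "z \<in> ball 0 1" for j z
    unfolding \<phi>_def
    by (rule DERIV_imp_deriv)
      (auto intro!: derivative_eq_intros holomorphic_derivI[OF E open_ball that]
        simp: algebra_simps power2_eq_square power3_eq_cube)
  have "deriv (deriv (\<phi> j)) 0 = 0" for j
  proof -
    have "\<forall>\<^sub>F z in nhds 0. deriv (\<phi> j) z = \<alpha> $ j + z\<^sup>2 * (3 * E j z + z * deriv (E j) z)"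
      unfolding eventually_nhds using D\<phi> by (intro exI[of _ "ball 0 1"]) auto
    then have "deriv (deriv (\<phi> j)) 0 =
        deriv (\<lambda>z. \<alpha> $ j + z\<^sup>2 * (3 * E j z + z * deriv (E j) z)) 0"
      by (rule deriv_cong_ev) simp
    also have "\<dots> = 0"
    proof (rule DERIV_imp_deriv)
      have z: "(0 :: complex) \<in> ball 0 1" by simp
      note holomorphic_derivI[OF E open_ball z]
        holomorphic_derivI[OF holomorphic_deriv[OF E open_ball] open_ball z]
      then show "((\<lambda>z. \<alpha> $ j + z\<^sup>2 * (3 * E j z + z * deriv (E j) z)) has_field_derivative 0) (at 0)"
        by (auto intro!: derivative_eq_intros)
    qed
    finally show ?thesis .
  qed
  then have jet: "\<phi> j 0 = \<omega> $ j" "deriv (\<phi> j) 0 = \<alpha> $ j" "deriv (deriv (\<phi> j)) 0 = 0" for j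
    by (simp_all add: D\<phi>) (simp add: \<phi>_def)
  have rho: "(\<lambda>z. f (\<chi> j. \<phi> j z)) holomorphic_on ball 0 1"
    "rho \<omega> \<alpha> f = upper_toeplitz (f (\<chi> j. \<phi> j 0)) (deriv (\<lambda>z. f (\<chi> j. \<phi> j z)) 0)
        (deriv (deriv (\<lambda>z. f (\<chi> j. \<phi> j z))) 0 / 2)" if "f \<in> H_inf" for f
    using rho_eq_upper_toeplitz_compose[where \<phi> = \<phi>, OF that \<phi> disc jet] by simp_all
  define \<Phi> where "\<Phi> = (\<lambda>z. \<chi> j. \<phi> j z)"
  have \<Phi>: "\<Phi> z \<in> polydisc" if "z \<in> ball 0 1" for z
    using disc[OF that] by (simp add: \<Phi>_def polydisc_def)
  have "matrix_norm (rho \<omega> \<alpha> f) \<le> polydisc_norm f" if f: "f \<in> H_inf" for f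
    unfolding rho(2)[OF f]
  proof (rule matrix_norm_upper_toeplitz_le[OF rho(1)[OF f]])
    fix z :: complex assume "z \<in> ball 0 1"
    obtain M where "\<And>z. z \<in> polydisc \<Longrightarrow> cmod (f z) \<le> M"
      using f by (auto simp: H_inf_def bounded_iff)
    then have "bdd_above ((\<lambda>z. cmod (f z)) ` polydisc)"
      by (rule bdd_aboveI2)
    then show "cmod (f (\<chi> j. \<phi> j z)) \<le> polydisc_norm f"
      unfolding polydisc_norm_def using \<Phi>[OF \<open>z \<in> ball 0 1\<close>]
      by (intro cSUP_upper) (simp add: \<Phi>_def)
  qed
  moreover have "hom_induced_by (T_mat \<omega> \<alpha>) (rho \<omega> \<alpha>)"
    unfolding hom_induced_by_def
  proof (intro conjI ballI allI)
    have ball0: "(0 :: complex) \<in> ball 0 1" by simp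
    show "rho \<omega> \<alpha> (\<lambda>z. 1) = mat 1"
      unfolding rho(2)[OF H_inf_const] mat_eq_upper_toeplitz by simp
    show "rho \<omega> \<alpha> (\<lambda>z. z $ j) = T_mat \<omega> \<alpha> j" for j
      unfolding rho(2)[OF H_inf_coordinate] T_mat_def by (simp add: jet)
    have mult: "rho \<omega> \<alpha> (\<lambda>z. f z * g z) = rho \<omega> \<alpha> f ** rho \<omega> \<alpha> g"
      if "f \<in> H_inf" "g \<in> H_inf" for f g
    proof -
      note fg = rho(1)[OF that(1)] rho(1)[OF that(2)]
      show ?thesis
        using higher_deriv_mult[OF fg open_ball ball0, of 1] higher_deriv_mult[OF fg open_ball ball0, of 2]
        unfolding rho(2)[OF that(1)] rho(2)[OF that(2)] rho(2)[OF H_inf_mult[OF that]]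
          upper_toeplitz_mult
        by (simp add: eval_nat_numeral algebra_simps add_divide_distrib)
    qed
    show "rho \<omega> \<alpha> (\<lambda>z. f z * g z) = rho \<omega> \<alpha> f ** rho \<omega> \<alpha> g" if "f \<in> H_inf" "g \<in> H_inf" for f g
      by (rule mult[OF that])
    \<comment> \<open>Scaling is multiplication by a constant function, which \<open>rho\<close> sends to a scalar matrix.\<close>
    show "rho \<omega> \<alpha> (\<lambda>z. c * f z) = mat c ** rho \<omega> \<alpha> f" if "f \<in> H_inf" for f c
    proof -
      have "rho \<omega> \<alpha> (\<lambda>z. c) = mat c"
        unfolding rho(2)[OF H_inf_const] mat_eq_upper_toeplitz by simp
      then show ?thesis using mult[OF H_inf_const that, of c] by simp
    qed
    show "rho \<omega> \<alpha> (\<lambda>z. f z + g z) = rho \<omega> \<alpha> f + rho \<omega> \<alpha> g" if "f \<in> H_inf" "g \<in> H_inf" for f g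
    proof -
      note fg = rho(1)[OF that(1)] rho(1)[OF that(2)]
      show ?thesis
        using higher_deriv_add[OF fg open_ball ball0, of 1] higher_deriv_add[OF fg open_ball ball0, of 2]
        unfolding rho(2)[OF that(1)] rho(2)[OF that(2)] rho(2)[OF H_inf_add[OF that]]
          upper_toeplitz_add
        by (simp add: eval_nat_numeral add_divide_distrib)
    qed
  qed
  ultimately show ?thesis by blast
qed

end
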